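(* Let $B=[-1,1]\times[-1,1]\subseteq\mathbb{R}^2$, let $z\in\mathbb{R}^2$, and suppose that $A=\mathbb{R}\times\{\alpha\}$, where $\alpha\in\mathbb{R}$ and $|\alpha|\le 1$. Let $(a_n)_{n\ge1}$, $(b_n)_{n\ge0}$ be the main sequences of Dykstra's algorithm for $(A,B,z)$ and $(c_n)_{n\ge 0}$ the MAP sequence with $c_0=z$. Then the main sequences of Dykstra's algorithm and the MAP sequence coincide, i.e. $c_{2n-1}=a_n$ and $c_{2n}=b_n$ for all $n\ge 1$; moreover, $P_{A\cap B}(z)=b_1=a_2=b_2=a_3=\cdots$.
   Context: $\mathbb{R}^2$ carries the Euclidean inner product, and $P_C$ denotes the projection onto a nonempty closed convex set $C$. Dykstra's algorithm for $(A,B,z)$: set $b_0=z$, $p_0=0$, $q_0=0$ and for $n\ge 1$ $a_n=P_A(b_{n-1}+p_{n-1})$, $p_n=b_{n-1}+p_{n-1}-a_n$, $b_n=P_B(a_n+q_{n-1})$, $q_n=a_n+q_{n-1}-b_n$. The main sequences are $(a_n)$ and $(b_n)$. Method of alternating projections (MAP): $c_0=z$, and $c_{2n-1}=P_A(c_{2n-2})$, $c_{2n}=P_B(c_{2n-1})$ for $n\ge 1$. *)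

theory Defs
  imports "HOL-Analysis.Analysis"
begin

(* The library's "closest_point C x" is the projection onto C of x, for C nonempty, closed
   and convex.

   The sequence a starts at index 1; dykstra_a A B z 0 is an arbitrary, unspecified value. *)

function (sequential)
  dykstra_a :: "'a::euclidean_space set \<Rightarrow> 'a set \<Rightarrow> 'a \<Rightarrow> nat \<Rightarrow> 'a" and
  dykstra_p :: "'a set \<Rightarrow> 'a set \<Rightarrow> 'a \<Rightarrow> nat \<Rightarrow> 'a" and
  dykstra_b :: "'a set \<Rightarrow> 'a set \<Rightarrow> 'a \<Rightarrow> nat \<Rightarrow> 'a" and
  dykstra_q :: "'a set \<Rightarrow> 'a set \<Rightarrow> 'a \<Rightarrow> nat \<Rightarrow> 'a"
where
  "dykstra_a A B z (Suc n) = closest_point A (dykstra_b A B z n + dykstra_p A B z n)"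
| "dykstra_p A B z 0 = 0"
| "dykstra_p A B z (Suc n) = dykstra_b A B z n + dykstra_p A B z n - dykstra_a A B z (Suc n)"
| "dykstra_b A B z 0 = z"
| "dykstra_b A B z (Suc n) = closest_point B (dykstra_a A B z (Suc n) + dykstra_q A B z n)"
| "dykstra_q A B z 0 = 0"
| "dykstra_q A B z (Suc n) = dykstra_a A B z (Suc n) + dykstra_q A B z n - dykstra_b A B z (Suc n)"
  by pat_completeness auto
termination
  by (relation "Wellfounded.measure (\<lambda>s. case s of
        Inl (Inl (A, B, z, n)) \<Rightarrow> 4 * n
      | Inl (Inr (A, B, z, n)) \<Rightarrow> 4 * n + 1
      | Inr (Inl (A, B, z, n)) \<Rightarrow> 4 * n + 2
      | Inr (Inr (A, B, z, n)) \<Rightarrow> 4 * n + 3)") auto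

primrec MAP :: "'a::euclidean_space set \<Rightarrow> 'a set \<Rightarrow> 'a \<Rightarrow> nat \<Rightarrow> 'a" where
  "MAP A B z 0 = z"
| "MAP A B z (Suc n) = closest_point (if odd (Suc n) then A else B) (MAP A B z n)"

end

theory Submission imports Defs begin

text \<open>
  Projections onto products are taken coordinatewise, so the vertical coordinate equals \<open>\<alpha>\<close> from the
  first step on and the correction \<open>p\<close> stays vertical, where the projection onto \<open>A\<close> ignores it. The
  correction \<open>q\<close> is horizontal and only restores the first coordinate to that of \<open>z\<close>, which \<open>B\<close>
  again projects to the first coordinate of \<open>b\<^sub>1\<close>.
\<close>

text \<open>The squared distance in a product is the sum of the squared distances of the components,
  so minimizing each component separately minimizes the whole.\<close>

lemma closest_point_Times:
  fixes S :: "'a::euclidean_space set" and T :: "'b::euclidean_space set"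
  assumes "convex S" "closed S" "S \<noteq> {}" "convex T" "closed T" "T \<noteq> {}"
  shows "closest_point (S \<times> T) (x, y) = (closest_point S x, closest_point T y)"
proof (rule closest_point_unique [symmetric])
  show "convex (S \<times> T)" "closed (S \<times> T)"
    using assms by (simp_all add: convex_Times closed_Times)
  show "(closest_point S x, closest_point T y) \<in> S \<times> T"
    using assms by (simp add: closest_point_in_set)
  show "\<forall>w\<in>S \<times> T. dist (x, y) (closest_point S x, closest_point T y) \<le> dist (x, y) w"
    using assms by (auto simp: dist_Pair_Pair intro!: real_sqrt_le_mono add_mono power_mono closest_point_le)
qed

theorem theorem4p2:
  fixes A B :: "(real \<times> real) set" and z :: "real \<times> real" and \<alpha> :: real
  assumes "B = {-1..1} \<times> {-1..1}"
    and "A = UNIV \<times> {\<alpha>}"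
    and "\<bar>\<alpha>\<bar> \<le> 1"
  shows "(\<forall>n\<ge>1. MAP A B z (2 * n - 1) = dykstra_a A B z n \<and> MAP A B z (2 * n) = dykstra_b A B z n)
    \<and> closest_point (A \<inter> B) z = dykstra_b A B z 1
    \<and> (\<forall>n\<ge>2. dykstra_a A B z n = closest_point (A \<inter> B) z \<and> dykstra_b A B z n = closest_point (A \<inter> B) z)"
proof -
  define I where "I = {-1..1::real}"
  define c where "c = closest_point I"
  \<comment> \<open>The point at which the sequences become stationary; it turns out to be the
    projection of \<open>z\<close> onto \<open>A \<inter> B\<close>.\<close>
  define w where "w = (c (fst z), \<alpha>)"
  have I: "convex I" "closed I" "I \<noteq> {}" by (auto simp: I_def)
  have \<alpha>: "\<alpha> \<in> I" using assms(3) by (auto simp: I_def)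
  have singleton: "closest_point {\<alpha>} y = \<alpha>" for y
    using closest_point_in_set[of "{\<alpha>}" y] by simp
  have c_c: "c (c x) = c x" for x
    by (simp add: c_def I closest_point_self closest_point_in_set)
  have c_\<alpha>: "c \<alpha> = \<alpha>" by (simp add: c_def \<alpha> closest_point_self)
  have P_A: "closest_point A (x, y) = (x, \<alpha>)" for x y
    unfolding assms(2) by (simp add: closest_point_Times closest_point_self singleton)
  have P_B: "closest_point B (x, y) = (c x, c y)" for x y
    using closest_point_Times[OF I I] by (simp add: assms(1) c_def I_def)
  \<comment> \<open>As \<alpha> lies in \<open>I\<close>, the line \<open>A\<close> meets the square
    in a full horizontal segment, again a product.\<close>
  have "A \<inter> B = I \<times> {\<alpha>}" using \<alpha> by (auto simp: assms(1,2) I_def)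
  then have P_AB: "closest_point (A \<inter> B) z = w"
    using closest_point_Times[OF I, of "{\<alpha>}" "fst z" "snd z"]
    by (simp add: singleton w_def c_def)
  have a_1: "dykstra_a A B z (Suc 0) = (fst z, \<alpha>)"
    using P_A[of "fst z" "snd z"] by simp
  \<comment> \<open>Only the first coordinate of \<open>p\<close> has to be controlled:
    \<open>P_A\<close> overwrites the second one with \<alpha>.\<close>
  have a_step: "dykstra_a A B z (Suc (Suc n)) = w"
    if "dykstra_b A B z (Suc n) = w" "fst (dykstra_p A B z (Suc n)) = 0" for n
    using that P_A[of "c (fst z)"]
    by (cases "dykstra_p A B z (Suc n)") (simp add: w_def del: dykstra_p.simps dykstra_b.simps)
  \<comment> \<open>The invariant begins at index 1, because \<open>b\<close> starts at the
    arbitrary point \<open>z\<close>.\<close>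
  have inv: "dykstra_b A B z (Suc n) = w \<and> fst (dykstra_p A B z (Suc n)) = 0
      \<and> dykstra_q A B z (Suc n) = (fst z - c (fst z), 0)" for n
  proof (induction n)
    case 0
    have b: "dykstra_b A B z (Suc 0) = w"
      using a_1 by (simp add: P_B c_\<alpha> w_def del: dykstra_a.simps)
    moreover have "fst (dykstra_p A B z (Suc 0)) = 0"
      using a_1 by (simp del: dykstra_a.simps)
    moreover have "dykstra_q A B z (Suc 0) = (fst z - c (fst z), 0)"
      using a_1 b by (simp add: w_def del: dykstra_a.simps dykstra_b.simps)
    ultimately show ?case by blast
  next
    case (Suc n)
    note a = a_step[OF conjunct1[OF Suc] conjunct1[OF conjunct2[OF Suc]]]
    \<comment> \<open>The argument of the projection is
      \<open>w + (fst z - c (fst z), 0) = (fst z, \<alpha>)\<close>, the same point as in the first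
      step.\<close>
    have b: "dykstra_b A B z (Suc (Suc n)) = w"
      unfolding dykstra_b.simps(2)[of _ _ _ "Suc n"] a using Suc
      by (simp add: P_B c_\<alpha> w_def)
    moreover have "fst (dykstra_p A B z (Suc (Suc n))) = 0"
      unfolding dykstra_p.simps(2)[of _ _ _ "Suc n"] a using Suc
      by (simp del: dykstra_b.simps dykstra_p.simps)
    moreover have "dykstra_q A B z (Suc (Suc n)) = (fst z - c (fst z), 0)"
      unfolding dykstra_q.simps(2)[of _ _ _ "Suc n"] a b using Suc
      by (simp del: dykstra_b.simps dykstra_q.simps)
    ultimately show ?case by blast
  qed
  \<comment> \<open>The index starts at 2: the first term is \<open>(fst z, \<alpha>)\<close>, which
    differs from \<open>w\<close> when \<open>fst z\<close> is outside \<open>I\<close>.\<close>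
  have a: "dykstra_a A B z (Suc (Suc n)) = w" for n
    using a_step inv by blast
  have MAP_even: "MAP A B z (Suc (Suc (2 * n))) = w" for n
  proof (induction n)
    case 0
    show ?case using P_A[of "fst z" "snd z"] by (simp add: P_B c_\<alpha> w_def)
  next
    case (Suc n)
    \<comment> \<open>MAP has no correction terms, so it stays at \<open>w\<close> because
      \<open>c\<close> is idempotent.\<close>
    then show ?case by (simp add: P_A P_B c_c c_\<alpha> w_def)
  qed
  have MAP_odd: "MAP A B z (Suc (2 * n)) = dykstra_a A B z (Suc n)" for n
  \<comment> \<open>At \<open>n = 0\<close> both sides are the projection of \<open>z\<close> onto
    \<open>A\<close>; afterwards both equal \<open>w\<close>, which lies in
    \<open>A\<close>.\<close>
  proof (cases n)
    case 0
    then show ?thesis by simp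
  next
    case (Suc m)
    then show ?thesis using MAP_even[of m] a[of m]
      by (simp add: w_def P_A del: dykstra_a.simps)
  qed
  show ?thesis
  proof (intro conjI allI impI)
    fix n :: nat
    assume "1 \<le> n"
    then obtain m where n: "n = Suc m" by (cases n) auto
    show "MAP A B z (2 * n - 1) = dykstra_a A B z n"
      using MAP_odd[of m] by (simp add: n del: dykstra_a.simps MAP.simps)
    show "MAP A B z (2 * n) = dykstra_b A B z n"
      using MAP_even[of m] inv[of m] by (simp add: n del: dykstra_b.simps MAP.simps)
  next
    show "closest_point (A \<inter> B) z = dykstra_b A B z 1"
      using inv[of 0] P_AB by simp
  next
    fix n :: nat
    assume "2 \<le> n"
    then obtain m where n: "n = Suc (Suc m)" by (metis Suc_le_D numeral_2_eq_2 Suc_le_mono)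
    show "dykstra_a A B z n = closest_point (A \<inter> B) z"
      using a[of m] P_AB n by simp
    show "dykstra_b A B z n = closest_point (A \<inter> B) z"
      using inv[of "Suc m"] P_AB n by simp
  qed
qed

end
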